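(* Let $n\ge 2$ and $k\ge 1$, let $x_1,\dots,x_n,y$ be propositional variables and let $s_{i,j}$ ($1\le i\le n-1$, $1\le j\le k$) be fresh propositional variables. The CNF formula consisting of the conjunction of $$(\neg x_1\vee s_{1,1}),$$ $$\bigwedge_{1<j\le k}(\neg y\vee\neg s_{1,j}),$$ $$\bigwedge_{1<i<n}(\neg x_i\vee s_{i,1})\wedge(\neg s_{i-1,1}\vee s_{i,1}),$$ $$\bigwedge_{1<i<n}\ \bigwedge_{1<j\le k}(\neg x_i\vee\neg s_{i-1,j-1}\vee s_{i,j})\wedge(\neg s_{i-1,j}\vee s_{i,j}),$$ $$\bigwedge_{1<i\le n}(\neg y\vee\neg x_i\vee\neg s_{i-1,k})$$ preserves the generalized arc consistency (by unit propagation) of $y\rightarrow\sum_{i=1}^n x_i\le k$.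
   Context: Unit propagation on a CNF formula repeatedly picks a unit clause $\{l\}$, deletes all clauses containing $l$ and removes the complement of $l$ from the other clauses; a literal is derived by unit propagation if it occurs as a unit clause at some stage, and a conflict is derived if the empty clause appears. For a set of literals $\rho$, unit propagation on $\mathcal F$ under $\rho$ means unit propagation on $\mathcal F\wedge\bigwedge_{l\in\rho}l$. A partial assignment of $x_1,\dots,x_n$ is a set of literals over these variables containing no complementary pair. A CNF formula $\mathcal F$ over $y,x_1,\dots,x_n$ and auxiliary variables preserves the generalized arc consistency (GAC) of $y\rightarrow\sum_{i=1}^n x_i\le k$ if for every partial assignment $\rho$ of $x_1,\dots,x_n$: (i) (when $y$ is true, GAC is maintained on the cardinality constraint) under $\rho\cup\{y\}$: if more than $k$ of the $x_i$ are true in $\rho$, unit propagation on $\mathcal F$ derives a conflict; and if exactly $k$ of the $x_i$ are true in $\rho$, unit propagation derives $\neg x_j$ for every $x_j$ not assigned by $\rho$; (ii) if more than $k$ of the $x_i$ are true in $\rho$ (the cardinality constraint is false), unit propagation on $\mathcal F$ under $\rho$ derives $\neg y$. *)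

theory Defs
  imports Main
begin

datatype 'v literal = Pos 'v | Neg 'v

fun compl :: "'v literal \<Rightarrow> 'v literal" where
  "compl (Pos v) = Neg v"
| "compl (Neg v) = Pos v"

type_synonym 'v clause = "'v literal set"
type_synonym 'v cnf = "'v clause set"

inductive up_step :: "'v cnf \<Rightarrow> 'v cnf \<Rightarrow> bool" where
  "{l} \<in> F \<Longrightarrow> up_step F ((\<lambda>C. C - {compl l}) ` {C \<in> F. l \<notin> C})"

text \<open>
  A stage of unit propagation on \<open>F\<close> is any formula reachable by steps from \<open>F\<close>; the choice of the
  unit clause in each step is free. The empty clause is never removed by a step, and propagation
  may continue after it has appeared.
\<close>

definition up_derives :: "'v cnf \<Rightarrow> 'v literal \<Rightarrow> bool" where
  "up_derives F l \<longleftrightarrow> (\<exists>G. up_step\<^sup>*\<^sup>* F G \<and> {l} \<in> G)"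

definition up_conflict :: "'v cnf \<Rightarrow> bool" where
  "up_conflict F \<longleftrightarrow> (\<exists>G. up_step\<^sup>*\<^sup>* F G \<and> {} \<in> G)"

definition under :: "'v cnf \<Rightarrow> 'v literal set \<Rightarrow> 'v cnf" where
  "under F \<rho> = F \<union> {{l} | l. l \<in> \<rho>}"

definition partial_assignment :: "'v set \<Rightarrow> 'v literal set \<Rightarrow> bool" where
  "partial_assignment V \<rho> \<longleftrightarrow>
     (\<forall>l\<in>\<rho>. \<exists>v\<in>V. l = Pos v \<or> l = Neg v) \<and> (\<forall>l\<in>\<rho>. compl l \<notin> \<rho>)"

definition num_true :: "nat \<Rightarrow> (nat \<Rightarrow> 'v) \<Rightarrow> 'v literal set \<Rightarrow> nat" where
  "num_true n x \<rho> = card {i \<in> {1..n}. Pos (x i) \<in> \<rho>}"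

text \<open>
  In the following, the variables are \<open>x 1, \<dots>, x n\<close>; values of \<open>x\<close> outside \<open>{1..n}\<close> are irrelevant.
  All variables of \<open>F\<close> other than these and \<open>y\<close> count as auxiliary.
\<close>

definition preserves_gac :: "'v cnf \<Rightarrow> 'v \<Rightarrow> nat \<Rightarrow> (nat \<Rightarrow> 'v) \<Rightarrow> nat \<Rightarrow> bool" where
  "preserves_gac F y n x k \<longleftrightarrow>
     (\<forall>\<rho>. partial_assignment (x ` {1..n}) \<rho> \<longrightarrow>
        (num_true n x \<rho> > k \<longrightarrow> up_conflict (under F (\<rho> \<union> {Pos y}))) \<and>
        (num_true n x \<rho> = k \<longrightarrow>
           (\<forall>j\<in>{1..n}. Pos (x j) \<notin> \<rho> \<and> Neg (x j) \<notin> \<rho> \<longrightarrow>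
              up_derives (under F (\<rho> \<union> {Pos y})) (Neg (x j)))) \<and>
        (num_true n x \<rho> > k \<longrightarrow> up_derives (under F \<rho>) (Neg y)))"

definition seq_counter ::
  "'v \<Rightarrow> nat \<Rightarrow> (nat \<Rightarrow> 'v) \<Rightarrow> nat \<Rightarrow> (nat \<Rightarrow> nat \<Rightarrow> 'v) \<Rightarrow> 'v cnf" where
  "seq_counter y n x k s =
     {{Neg (x 1), Pos (s 1 1)}}
   \<union> {{Neg y, Neg (s 1 j)} | j. 1 < j \<and> j \<le> k}
   \<union> {{Neg (x i), Pos (s i 1)} | i. 1 < i \<and> i < n}
   \<union> {{Neg (s (i - 1) 1), Pos (s i 1)} | i. 1 < i \<and> i < n}
   \<union> {{Neg (x i), Neg (s (i - 1) (j - 1)), Pos (s i j)} | i j. 1 < i \<and> i < n \<and> 1 < j \<and> j \<le> k}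
   \<union> {{Neg (s (i - 1) j), Pos (s i j)} | i j. 1 < i \<and> i < n \<and> 1 < j \<and> j \<le> k}
   \<union> {{Neg y, Neg (x i), Neg (s (i - 1) k)} | i. 1 < i \<and> i \<le> n}"

end

theory Submission
  imports Defs
begin

text \<open>
  Write \<open>c i\<close> for the number of true variables among \<open>x 1, \<dots>, x i\<close>. Forward propagation derives
  \<open>s i j\<close> whenever \<open>j \<le> c i\<close>, so the \<open>(k + 1)\<close>-st true variable forces \<open>\<not> y\<close>. If \<open>y\<close> holds and
  \<open>c n = k\<close>, backward propagation from the last true variable derives \<open>\<not> s i (c i + 1)\<close> whenever
  \<open>c i < k\<close>; the forward and backward literals around an unassigned \<open>x j\<close> meet in a clause that forces
  \<open>\<not> x j\<close>.

  Propagating a literal destroys the clauses that contain it, so a chain of unit inferences can be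
  replayed by propagation steps only if it uses no complementary literals. The inferences are
  therefore confined to a complement-free set \<open>M\<close> given in advance.
\<close>

section \<open>Unit inferences inside a consistent set of literals\<close>

definition consistent :: "'v literal set \<Rightarrow> bool" where
  "consistent M \<longleftrightarrow> (\<forall>l\<in>M. compl l \<notin> M)"

lemma consistent_valuation: "consistent ({Pos v | v. T v} \<union> {Neg v | v. \<not> T v})"
  by (auto simp: consistent_def)

lemma compl_compl [simp]: "compl (compl l) = l"
  by (cases l) auto

text \<open>Closed form of the formula left once all literals of \<open>P\<close> are propagated. It
  depends on the set \<open>P\<close> alone, so the order of the steps can be forgotten.\<close>

definition residual :: "'v cnf \<Rightarrow> 'v literal set \<Rightarrow> 'v cnf" where
  "residual F P = (\<lambda>C. C - compl ` P) ` {C \<in> F. C \<inter> P = {}}"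

lemma residual_empty [simp]: "residual F {} = F"
  by (simp add: residual_def)

text \<open>Since \<open>l\<close> survives in the residual, it is not the complement of a literal
  of \<open>P\<close>. Earlier removals therefore never took \<open>l\<close> out of a clause, and
  the clauses to delete are the same before and after them.\<close>

lemma up_step_residual:
  assumes "{l} \<in> residual F P"
  shows "up_step (residual F P) (residual F (insert l P))"
proof -
  have l: "l \<notin> compl ` P"
    using assms by (auto simp: residual_def)
  then have "{C \<in> residual F P. l \<notin> C} = (\<lambda>C. C - compl ` P) ` {C \<in> F. C \<inter> insert l P = {}}"
    by (auto simp: residual_def)
  then have "(\<lambda>C. C - {compl l}) ` {C \<in> residual F P. l \<notin> C} = residual F (insert l P)"
    by (auto simp: residual_def image_image intro!: image_cong)
  then show ?thesis
    using up_step.intros[OF assms] by simp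
qed

text \<open>Nothing requires \<open>l\<close> to be new, and the premises only have to lie in
  \<open>P\<close>; hence one trail can be replayed on top of another, as in
  \<open>trail_Un\<close>.\<close>

inductive trail :: "'v cnf \<Rightarrow> 'v literal set \<Rightarrow> 'v literal set \<Rightarrow> bool" for F M where
  empty: "trail F M {}"
| insert: "trail F M P \<Longrightarrow> C \<in> F \<Longrightarrow> l \<in> C \<Longrightarrow> l \<in> M \<Longrightarrow> compl ` (C - {l}) \<subseteq> P
    \<Longrightarrow> trail F M (insert l P)"

lemma trail_subset: "trail F M P \<Longrightarrow> P \<subseteq> M"
  by (induction rule: trail.induct) auto

lemma trail_Un:
  assumes "trail F M P" and "trail F M Q"
  shows "trail F M (P \<union> Q)"
  using assms(2)
proof (induction rule: trail.induct)
  case empty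
  then show ?case using assms(1) by simp
next
  case (insert Q C l)
  then have "trail F M (insert l (P \<union> Q))"
    by - (rule trail.insert[of F M "P \<union> Q" C], auto)
  then show ?case by simp
qed

lemma trail_UN:
  assumes "finite I" and "\<And>i. i \<in> I \<Longrightarrow> trail F M (P i)"
  shows "trail F M (\<Union>i\<in>I. P i)"
  using assms by (induction rule: finite_induct) (auto intro: trail.empty trail_Un)

text \<open>If \<open>l\<close> is new, consistency of \<open>M\<close> ensures that the clause
  \<open>C\<close> behind the inference meets no literal of \<open>P\<close>, so it is not deleted,
  and that \<open>l\<close> is never removed from it: in the residual \<open>C\<close> has shrunk to
  exactly \<open>{l}\<close>.\<close>

lemma trail_reachable:
  assumes "trail F M P" and "consistent M"
  shows "up_step\<^sup>*\<^sup>* F (residual F P) \<and> (\<forall>l\<in>P. up_derives F l)"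
  using assms(1)
proof (induction rule: trail.induct)
  case empty
  then show ?case by simp
next
  case (insert P C l)
  show ?case
  proof (cases "l \<in> P")
    case True
    then show ?thesis using insert.IH by (simp add: insert_absorb)
  next
    case False
    have PM: "insert l P \<subseteq> M"
      using trail_subset[OF insert.hyps(1)] \<open>l \<in> M\<close> by simp
    have C: "C - {l} \<subseteq> compl ` P"
    proof
      fix a assume "a \<in> C - {l}"
      then have "compl a \<in> P" using insert.hyps(5) by blast
      then show "a \<in> compl ` P" by (intro image_eqI[of _ _ "compl a"]) simp_all
    qed
    have "a \<notin> compl ` P" if "a \<in> insert l P" for a
    proof
      assume "a \<in> compl ` P"
      then have "compl a \<in> P" by auto
      then show False using that PM assms(2) by (auto simp: consistent_def)
    qed
    then have "C \<inter> P = {}" and "C - compl ` P = {l}"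
      using C False \<open>l \<in> C\<close> by blast+
    then have unit: "{l} \<in> residual F P"
      using \<open>C \<in> F\<close> unfolding residual_def by (intro image_eqI[of _ _ C]) simp_all
    then have "up_derives F l"
      using insert.IH unfolding up_derives_def by blast
    moreover have "up_step\<^sup>*\<^sup>* F (residual F (insert l P))"
      using rtranclp.rtrancl_into_rtrancl[OF conjunct1[OF insert.IH] up_step_residual[OF unit]] .
    ultimately show ?thesis using insert.IH by blast
  qed
qed

text \<open>Tree-shaped derivations: each premise has its own, so the counter arguments carry no
  accumulated set. Finiteness of \<open>C\<close> lets the trails of the premises be united.\<close>

inductive propagates :: "'v cnf \<Rightarrow> 'v literal set \<Rightarrow> 'v literal \<Rightarrow> bool" for F M where
  step: "C \<in> F \<Longrightarrow> l \<in> C \<Longrightarrow> l \<in> M \<Longrightarrow> finite C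
    \<Longrightarrow> (\<And>a. a \<in> C - {l} \<Longrightarrow> propagates F M (compl a)) \<Longrightarrow> propagates F M l"

lemma propagates_mono: "propagates F M l \<Longrightarrow> F \<subseteq> G \<Longrightarrow> propagates G M l"
proof (induction rule: propagates.induct)
  case (step C l)
  then show ?case by - (rule propagates.step[of C], auto)
qed

lemma propagates_trail: "propagates F M l \<Longrightarrow> \<exists>P. trail F M P \<and> l \<in> P"
proof (induction rule: propagates.induct)
  case (step C l)
  then obtain P where P: "\<And>a. a \<in> C - {l} \<Longrightarrow> trail F M (P a) \<and> compl a \<in> P a"
    by metis
  have "trail F M (\<Union>a\<in>C - {l}. P a)"
    using P \<open>finite C\<close> by (intro trail_UN) auto
  then have "trail F M (insert l (\<Union>a\<in>C - {l}. P a))"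
    using step.hyps P by - (rule trail.insert[where C = C], blast+)
  then show ?case by blast
qed

lemma propagates_up_derives:
  "propagates F M l \<Longrightarrow> consistent M \<Longrightarrow> up_derives F l"
  using propagates_trail trail_reachable by blast

text \<open>As \<open>M\<close> contains \<open>l\<close>, the unit clause \<open>{compl l}\<close>
  is never itself propagated; it stays until propagating \<open>l\<close> empties it.\<close>

lemma propagates_up_conflict:
  assumes "propagates F M l" and "consistent M" and "{compl l} \<in> F"
  shows "up_conflict F"
proof -
  obtain P where P: "trail F M P" "l \<in> P"
    using propagates_trail[OF assms(1)] by blast
  then have "compl l \<notin> P"
    using trail_subset assms(2) unfolding consistent_def by blast
  then have "{} \<in> residual F P"
    using assms(3) P(2) unfolding residual_def by (intro image_eqI[where x = "{compl l}"]) auto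
  then show ?thesis
    using trail_reachable[OF P(1) assms(2)] unfolding up_conflict_def by blast
qed

lemma propagates_unit: "{l} \<in> F \<Longrightarrow> l \<in> M \<Longrightarrow> propagates F M l"
  by (rule propagates.step[where C = "{l}"]) auto

lemma propagates_binary:
  "{a, l} \<in> F \<Longrightarrow> l \<in> M \<Longrightarrow> propagates F M (compl a) \<Longrightarrow> propagates F M l"
  by (rule propagates.step[where C = "{a, l}"]) auto

lemma propagates_ternary:
  "{a, b, l} \<in> F \<Longrightarrow> l \<in> M \<Longrightarrow> propagates F M (compl a) \<Longrightarrow> propagates F M (compl b)
    \<Longrightarrow> propagates F M l"
  by (rule propagates.step[where C = "{a, b, l}"]) auto

section \<open>Propagation in the sequential counter\<close>

lemma seq_counter_clauses:
  shows "{Neg (x 1), Pos (s 1 1)} \<in> seq_counter y n x k s"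
    and "\<lbrakk>1 < i; i < n\<rbrakk> \<Longrightarrow> {Neg (x i), Pos (s i 1)} \<in> seq_counter y n x k s"
    and "\<lbrakk>1 < i; i < n; 1 \<le> j; j \<le> k\<rbrakk> \<Longrightarrow> {Neg (s (i - 1) j), Pos (s i j)} \<in> seq_counter y n x k s"
    and "\<lbrakk>1 < i; i < n; 1 < j; j \<le> k\<rbrakk>
      \<Longrightarrow> {Neg (x i), Neg (s (i - 1) (j - 1)), Pos (s i j)} \<in> seq_counter y n x k s"
    and "\<lbrakk>1 < i; i \<le> n\<rbrakk> \<Longrightarrow> {Neg y, Neg (x i), Neg (s (i - 1) k)} \<in> seq_counter y n x k s"
proof -
  assume "1 < i" "i < n" "1 \<le> j" "j \<le> k"
  then show "{Neg (s (i - 1) j), Pos (s i j)} \<in> seq_counter y n x k s"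
    by (cases "j = 1") (unfold seq_counter_def, blast, force)
qed (unfold seq_counter_def, blast+)

lemma num_true_0 [simp]: "num_true 0 x \<rho> = 0"
  by (simp add: num_true_def)

lemma num_true_Suc:
  "num_true (Suc i) x \<rho> = num_true i x \<rho> + (if Pos (x (Suc i)) \<in> \<rho> then 1 else 0)"
proof -
  have "{j \<in> {1..Suc i}. Pos (x j) \<in> \<rho>} =
      (if Pos (x (Suc i)) \<in> \<rho> then insert (Suc i) {j \<in> {1..i}. Pos (x j) \<in> \<rho>}
       else {j \<in> {1..i}. Pos (x j) \<in> \<rho>})"
    by (auto simp: le_Suc_eq)
  then show ?thesis by (simp add: num_true_def)
qed

lemma num_true_mono: "i \<le> j \<Longrightarrow> num_true i x \<rho> \<le> num_true j x \<rho>"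
  unfolding num_true_def by (intro card_mono) auto

text \<open>\<open>s i j\<close> stands for "at least \<open>j\<close> of the first \<open>i\<close>
  variables are true". Either the count reached \<open>j\<close> earlier and the literal is copied,
  or the new variable is the \<open>j\<close>-th true one.\<close>

lemma counter_forward:
  assumes G: "seq_counter y n x k s \<subseteq> G"
    and lits: "\<And>i. Pos (x i) \<in> \<rho> \<Longrightarrow> propagates G M (Pos (x i))"
    and M: "\<And>i j. \<lbrakk>1 \<le> i; i < n; 1 \<le> j; j \<le> k; j \<le> num_true i x \<rho>\<rbrakk> \<Longrightarrow> Pos (s i j) \<in> M"
    and "1 \<le> i" "i < n" "1 \<le> j" "j \<le> k" "j \<le> num_true i x \<rho>"
  shows "propagates G M (Pos (s i j))"
  using assms(4-)
proof (induction i arbitrary: j)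
  case 0
  then show ?case by simp
next
  case (Suc i)
  note cl = seq_counter_clauses[where x = x and s = s and y = y and n = n and k = k, THEN subsetD[OF G]]
  have M': "Pos (s (Suc i) j) \<in> M"
    using Suc.prems by (intro M) auto
  show ?case
  proof (cases "i = 0")
    case True
    then have "j = 1" and "Pos (x 1) \<in> \<rho>"
      using Suc.prems by (auto simp: num_true_Suc split: if_splits)
    then show ?thesis
      using propagates_binary[OF cl(1)] M' lits True by simp
  next
    case i: False
    show ?thesis
    proof (cases "j \<le> num_true i x \<rho>")
      case True
      then have "propagates G M (Pos (s i j))"
        using Suc i by simp
      then show ?thesis
        using propagates_binary[OF cl(3)[of "Suc i" j]] M' Suc.prems i by simp
    next
      case False
      then have j: "j = Suc (num_true i x \<rho>)" and x: "Pos (x (Suc i)) \<in> \<rho>"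
        using Suc.prems by (auto simp: num_true_Suc split: if_splits)
      show ?thesis
      proof (cases "j = 1")
        case True
        then show ?thesis
          using propagates_binary[OF cl(2)[of "Suc i"]] M' Suc.prems i lits[OF x] by simp
      next
        case False
        then have "propagates G M (Pos (s i (j - 1)))"
          using Suc i j by simp
        then show ?thesis
          using propagates_ternary[OF cl(4)[of "Suc i" j]] M' Suc.prems i lits[OF x] False by simp
      qed
    qed
  qed
qed

text \<open>One more true variable among the first \<open>i\<close> would push the total beyond
  \<open>k\<close>. The derivation starts just before the \<open>k\<close>-th true variable, with
  the clause containing \<open>y\<close>, and descends through the counter clauses read
  contrapositively.\<close>

lemma counter_backward:
  assumes G: "seq_counter y n x k s \<subseteq> G"
    and lits: "\<And>i. Pos (x i) \<in> \<rho> \<Longrightarrow> propagates G M (Pos (x i))"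
    and y: "propagates G M (Pos y)"
    and M: "\<And>i. \<lbrakk>1 \<le> i; i < n; num_true i x \<rho> < k\<rbrakk> \<Longrightarrow> Neg (s i (Suc (num_true i x \<rho>))) \<in> M"
    and k: "num_true n x \<rho> = k"
    and "i \<le> n" "1 \<le> i" "num_true i x \<rho> < k"
  shows "propagates G M (Neg (s i (Suc (num_true i x \<rho>))))"
  using assms(6-)
proof (induction rule: inc_induct)
  case base
  then show ?case using k by simp
next
  case (step i)
  note cl = seq_counter_clauses[where x = x and s = s and y = y and n = n and k = k, THEN subsetD[OF G]]
  have M': "Neg (s i (Suc (num_true i x \<rho>))) \<in> M"
    using step by (intro M) auto
  show ?case
  proof (cases "num_true (Suc i) x \<rho> = k")
    case True
    then have ki: "k = Suc (num_true i x \<rho>)" and x: "Pos (x (Suc i)) \<in> \<rho>"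
      using step.prems by (auto simp: num_true_Suc split: if_splits)
    then have "{Neg y, Neg (x (Suc i)), Neg (s i (Suc (num_true i x \<rho>)))} \<in> G"
      using cl(5)[of "Suc i"] step by simp
    then show ?thesis
      by (rule propagates_ternary) (use M' y lits[OF x] in auto)
  next
    case False
    then have "Suc i < n"
      using step.hyps k by (cases "Suc i = n") auto
    then have less: "num_true (Suc i) x \<rho> < k" "Suc i < n"
      using False k num_true_mono[of "Suc i" n x \<rho>] by auto
    then have IH: "propagates G M (Neg (s (Suc i) (Suc (num_true (Suc i) x \<rho>))))"
      using step by simp
    show ?thesis
    proof (cases "Pos (x (Suc i)) \<in> \<rho>")
      case True
      then have c: "num_true (Suc i) x \<rho> = Suc (num_true i x \<rho>)"
        by (simp add: num_true_Suc)
      \<comment> \<open>A true variable raises the count by one, so the literal refuted at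
        \<open>Suc i\<close> lies one column further than the one to refute at
        \<open>i\<close>.\<close>
      then have "{Neg (x (Suc i)), Pos (s (Suc i) (Suc (Suc (num_true i x \<rho>)))),
          Neg (s i (Suc (num_true i x \<rho>)))} \<in> G"
        using cl(4)[of "Suc i" "Suc (Suc (num_true i x \<rho>))"] less step by (simp add: insert_commute)
      then show ?thesis
        by (rule propagates_ternary) (use M' lits[OF True] IH c in auto)
    next
      case False
      then have c: "num_true (Suc i) x \<rho> = num_true i x \<rho>"
        by (simp add: num_true_Suc)
      then have "{Pos (s (Suc i) (Suc (num_true i x \<rho>))), Neg (s i (Suc (num_true i x \<rho>)))} \<in> G"
        using cl(3)[of "Suc i" "Suc (num_true i x \<rho>)"] less step by (simp add: insert_commute)
      then show ?thesis
        by (rule propagates_binary) (use M' IH c in auto)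
    qed
  qed
qed

text \<open>The count starts at 0 and grows by at most one per variable, so it equals
  \<open>k\<close> just before the variable that exceeds it.\<close>

lemma num_true_crossing:
  assumes "k < num_true n x \<rho>"
  shows "\<exists>i<n. num_true i x \<rho> = k \<and> Pos (x (Suc i)) \<in> \<rho>"
  using assms by (induction n) (auto simp: num_true_Suc less_Suc_eq split: if_splits)

text \<open>At the crossing point forward propagation gives \<open>s i k\<close>, and the next true
  variable is one too many.\<close>

lemma counter_overflow:
  assumes "k \<ge> 1" and G: "seq_counter y n x k s \<subseteq> G"
    and lits: "\<And>i. Pos (x i) \<in> \<rho> \<Longrightarrow> propagates G M (Pos (x i))"
    and M: "\<And>i j. \<lbrakk>1 \<le> i; i < n; 1 \<le> j; j \<le> k; j \<le> num_true i x \<rho>\<rbrakk> \<Longrightarrow> Pos (s i j) \<in> M"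
    and "Neg y \<in> M" and "k < num_true n x \<rho>"
  shows "propagates G M (Neg y)"
proof -
  obtain i where i: "i < n" "num_true i x \<rho> = k" "Pos (x (Suc i)) \<in> \<rho>"
    using num_true_crossing[OF assms(6)] by blast
  then have "1 \<le> i"
    using \<open>k \<ge> 1\<close> by (cases i) auto
  then have "propagates G M (Pos (s i k))"
    using i \<open>k \<ge> 1\<close> by (intro counter_forward[OF G lits M]) auto
  moreover have "{Neg (x (Suc i)), Neg (s i k), Neg y} \<in> G"
    using subsetD[OF G seq_counter_clauses(5)[of "Suc i"]] i \<open>1 \<le> i\<close> by (simp add: insert_commute)
  ultimately show ?thesis
    using propagates_ternary[of "Neg (x (Suc i))" "Neg (s i k)"] lits[OF i(3)] \<open>Neg y \<in> M\<close> by auto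
qed

text \<open>With \<open>c\<close> true variables before \<open>x j\<close>, a true
  \<open>x j\<close> would turn \<open>s i c\<close> into \<open>s j (c + 1)\<close>, which backward
  propagation refutes. For \<open>c = k\<close> the clause with \<open>y\<close> is used instead;
  for \<open>c = 0\<close> no forward literal is needed.\<close>

lemma counter_saturated:
  assumes "k \<ge> 1" and G: "seq_counter y n x k s \<subseteq> G"
    and lits: "\<And>i. Pos (x i) \<in> \<rho> \<Longrightarrow> propagates G M (Pos (x i))"
    and y: "propagates G M (Pos y)"
    and M: "\<And>i j. \<lbrakk>1 \<le> i; i < n; 1 \<le> j; j \<le> k; j \<le> num_true i x \<rho>\<rbrakk> \<Longrightarrow> Pos (s i j) \<in> M"
      "\<And>i. \<lbrakk>1 \<le> i; i < n; num_true i x \<rho> < k\<rbrakk> \<Longrightarrow> Neg (s i (Suc (num_true i x \<rho>))) \<in> M"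
    and k: "num_true n x \<rho> = k"
    and j: "j \<in> {1..n}" "Pos (x j) \<notin> \<rho>" "Neg (x j) \<in> M"
  shows "propagates G M (Neg (x j))"
proof -
  note cl = seq_counter_clauses[where x = x and s = s and y = y and n = n and k = k, THEN subsetD[OF G]]
  define i where "i = j - 1"
  then have ji: "j = Suc i" using j by simp
  have c: "num_true j x \<rho> = num_true i x \<rho>"
    using j by (simp add: ji num_true_Suc)
  have ck: "num_true i x \<rho> \<le> k"
    using num_true_mono[of i n x \<rho>] j k ji by simp
  have below: "propagates G M (Pos (s i (num_true i x \<rho>)))" if "1 \<le> num_true i x \<rho>"
  proof -
    have "1 \<le> i" using that by (cases i) auto
    then show ?thesis
      using that ck j ji by (intro counter_forward[OF G lits M(1)]) auto
  qed
  show ?thesis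
  proof (cases "num_true i x \<rho> = k")
    case True
    then have "1 \<le> i" using \<open>k \<ge> 1\<close> by (cases i) auto
    then have "{Neg y, Neg (s i k), Neg (x j)} \<in> G"
      using cl(5)[of j] j ji by (simp add: insert_commute)
    then show ?thesis
      by (rule propagates_ternary) (use j y below True \<open>k \<ge> 1\<close> in auto)
  next
    case False
    then have less: "num_true i x \<rho> < k" using ck by simp
    \<comment> \<open>At \<open>j = n\<close> the count would already be \<open>k\<close>.\<close>
    then have "j < n" using c k j by (cases "j = n") auto
    then have above: "propagates G M (Neg (s j (Suc (num_true i x \<rho>))))"
      using counter_backward[OF G lits y M(2) k, of j] less c j by simp
    show ?thesis
    proof (cases "num_true i x \<rho> = 0")
      case True
      have "{Pos (s j 1), Neg (x j)} \<in> G"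
        using cl(1) cl(2)[of j] \<open>j < n\<close> ji by (cases "i = 0") (simp_all add: insert_commute)
      then show ?thesis
        by (rule propagates_binary) (use j above True in auto)
    next
      case False
      then have "1 < j" using ji by (cases i) auto
      then have "{Neg (s i (num_true i x \<rho>)), Pos (s j (Suc (num_true i x \<rho>))), Neg (x j)} \<in> G"
        using cl(4)[of j "Suc (num_true i x \<rho>)"] \<open>j < n\<close> less False ji by (simp add: insert_commute)
      then show ?thesis
        by (rule propagates_ternary) (use j above below False in auto)
    qed
  qed
qed

theorem proposition5:
  fixes n k :: nat and y :: 'v and x :: "nat \<Rightarrow> 'v" and s :: "nat \<Rightarrow> nat \<Rightarrow> 'v"
  assumes "n \<ge> 2" and "k \<ge> 1"
    and "inj_on x {1..n}" and "y \<notin> x ` {1..n}"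
    and "inj_on (\<lambda>(i, j). s i j) ({1..n - 1} \<times> {1..k})"
    and "\<forall>i\<in>{1..n - 1}. \<forall>j\<in>{1..k}. s i j \<noteq> y \<and> s i j \<notin> x ` {1..n}"
  shows "preserves_gac (seq_counter y n x k s) y n x k"
proof -
  let ?F = "seq_counter y n x k s"
  define S where "S = {1..n - 1} \<times> {1..k}"
  have s_inj: "i = i' \<and> j = j'" if "s i j = s i' j'" "(i, j) \<in> S" "(i', j') \<in> S" for i j i' j'
    using that inj_onD[OF assms(5), of "(i, j)" "(i', j')"] by (simp add: S_def)
  have s_fresh: "s i j \<noteq> y" "s i j \<notin> x ` {1..n}" if "(i, j) \<in> S" for i j
    using that assms(6) by (auto simp: S_def)
  have "(num_true n x \<rho> > k \<longrightarrow> up_conflict (under ?F (\<rho> \<union> {Pos y}))) \<and>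
        (num_true n x \<rho> = k \<longrightarrow>
           (\<forall>j\<in>{1..n}. Pos (x j) \<notin> \<rho> \<and> Neg (x j) \<notin> \<rho> \<longrightarrow>
              up_derives (under ?F (\<rho> \<union> {Pos y})) (Neg (x j)))) \<and>
        (num_true n x \<rho> > k \<longrightarrow> up_derives (under ?F \<rho>) (Neg y))"
    if "partial_assignment (x ` {1..n}) \<rho>" for \<rho>
  proof -
    have dom: "v \<in> x ` {1..n}" if "Pos v \<in> \<rho> \<or> Neg v \<in> \<rho>" for v
      using \<open>partial_assignment _ \<rho>\<close> that unfolding partial_assignment_def by blast
    have clash: "\<not> (Pos v \<in> \<rho> \<and> Neg v \<in> \<rho>)" for v
      using \<open>partial_assignment _ \<rho>\<close> unfolding partial_assignment_def by force
    \<comment> \<open>The intended valuation: unassigned \<open>x\<close> are false and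
      \<open>s i j\<close> compares \<open>j\<close> with the count. The value \<open>b\<close> of
      \<open>y\<close> is \<open>False\<close> for deriving \<open>Neg y\<close> and
      \<open>True\<close> for propagating with \<open>y\<close>.\<close>
    define T where "T b v \<longleftrightarrow> v = y \<and> b \<or> Pos v \<in> \<rho> \<or>
      (\<exists>i j. (i, j) \<in> S \<and> v = s i j \<and> j \<le> num_true i x \<rho>)" for b v
    define M where "M b = {Pos v | v. T b v} \<union> {Neg v | v. \<not> T b v}" for b
    have M: "consistent (M b)" for b
      unfolding M_def by (rule consistent_valuation)
    have \<rho>: "l \<in> M b" if "l \<in> \<rho>" for l b
    proof (cases l)
      case (Pos v)
      then show ?thesis using that by (auto simp: M_def T_def)
    next
      case (Neg v)
      then have "v \<in> x ` {1..n}" and "Pos v \<notin> \<rho>"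
        using that dom clash by blast+
      then have "\<not> T b v"
        using s_fresh(2) assms(4) unfolding T_def by metis
      then show ?thesis using Neg by (simp add: M_def)
    qed
    have y: "Neg y \<in> M False" "Pos y \<in> M True"
      using dom[of y] s_fresh(1) assms(4) by (auto simp: M_def T_def)
    have s_pos: "Pos (s i j) \<in> M b" if "1 \<le> i" "i < n" "1 \<le> j" "j \<le> k" "j \<le> num_true i x \<rho>" for i j b
    proof -
      have "(i, j) \<in> S" using that by (auto simp: S_def)
      then show ?thesis using that by (auto simp: M_def T_def)
    qed
    have s_neg: "Neg (s i (Suc (num_true i x \<rho>))) \<in> M b"
      if "1 \<le> i" "i < n" "num_true i x \<rho> < k" for i b
    proof -
      have S: "(i, Suc (num_true i x \<rho>)) \<in> S" using that by (auto simp: S_def)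
      \<comment> \<open>By injectivity of \<open>s\<close> on \<open>S\<close>, only this index pair
        could make the variable true, and its column exceeds the count.\<close>
      then have "\<not> T b (s i (Suc (num_true i x \<rho>)))"
        using s_fresh[OF S] dom s_inj[OF _ S] unfolding T_def by (metis Suc_n_not_le_n)
      then show ?thesis by (simp add: M_def)
    qed
    have x_neg: "Neg (x j) \<in> M b" if "j \<in> {1..n}" "Pos (x j) \<notin> \<rho>" for j b
    proof -
      have "x j \<in> x ` {1..n}" using that by simp
      then have "\<not> T b (x j)"
        using s_fresh(2) assms(4) that unfolding T_def by metis
      then show ?thesis by (simp add: M_def)
    qed
    have over: "propagates (under ?F \<rho>) (M False) (Neg y)" if "num_true n x \<rho> > k"
      by (rule counter_overflow[OF \<open>k \<ge> 1\<close> _ _ s_pos y(1) that])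
        (auto simp: under_def intro: propagates_unit \<rho>)
    have sat: "propagates (under ?F (\<rho> \<union> {Pos y})) (M True) (Neg (x j))"
      if "num_true n x \<rho> = k" "j \<in> {1..n}" "Pos (x j) \<notin> \<rho>" for j
      by (rule counter_saturated[where x = x and s = s and y = y and \<rho> = \<rho>,
            OF \<open>k \<ge> 1\<close> _ _ _ s_pos s_neg that x_neg[OF that(2,3)]])
        (auto simp: under_def intro: propagates_unit \<rho> y)
    \<comment> \<open>The derivation of \<open>Neg y\<close> is reused for the conflict: inside
      \<open>M False\<close> the added unit clause of \<open>y\<close> is not propagated but
      emptied.\<close>
    have sub: "under ?F \<rho> \<subseteq> under ?F (\<rho> \<union> {Pos y})" and unit_y: "{compl (Neg y)} \<in> under ?F (\<rho> \<union> {Pos y})"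
      by (auto simp: under_def)
    show ?thesis
    proof (intro conjI impI ballI)
      assume *: "num_true n x \<rho> > k"
      show "up_conflict (under ?F (\<rho> \<union> {Pos y}))"
        by (rule propagates_up_conflict[OF propagates_mono[OF over[OF *] sub] M unit_y])
      show "up_derives (under ?F \<rho>) (Neg y)"
        by (rule propagates_up_derives[OF over[OF *] M])
    next
      fix j assume "num_true n x \<rho> = k" "j \<in> {1..n}" "Pos (x j) \<notin> \<rho> \<and> Neg (x j) \<notin> \<rho>"
      then show "up_derives (under ?F (\<rho> \<union> {Pos y})) (Neg (x j))"
        using propagates_up_derives[OF sat M] by blast
    qed
  qed
  then show ?thesis
    unfolding preserves_gac_def by blast
qed

end
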